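(* Let $n$ be a positive integer, $l>0$, and let $0<m<n$ be a constant. Let $\theta_1,\dots,\theta_n$ and $\psi_1,\dots,\psi_n$ be real numbers in $(0,l)$ with $\sum_{i=1}^n\theta_i=ml=\sum_{i=1}^n\psi_i$. Let $f$ be a positive $C^2$-function on $(0,l)$ such that, for some constant $\mu$, $$\left(f'(\theta)\right)^2-f(\theta)f''(\theta)=\mu\quad\text{for all }\theta\in(0,l),$$ and $f'(\theta)f''(\theta)\neq 0$ on $(0,l)$. (i)(1) If $f''(\theta)<0$ and $f'(\theta)>0$ on $(0,l)$, then $$2\sum_{i=1}^{n}f(\theta_i)f'(\psi_i)\geq\sum_{i=1}^{n}f(\theta_i)f'(\theta_i)+\sum_{i=1}^{n}f(\psi_i)f'(\psi_i).$$ (i)(2) If $f''(\theta)<0$ and $f'(\theta)<0$ on $(0,l)$, then $$2\sum_{i=1}^{n}f(\theta_i)f'(\psi_i)\leq\sum_{i=1}^{n}f(\theta_i)f'(\theta_i)+\sum_{i=1}^{n}f(\psi_i)f'(\psi_i).$$ (ii)(1) If $f''(\theta)>0$ and $f'(\theta)>0$ on $(0,l)$, then $$2\sum_{i=1}^{n}f(\theta_i)f'(\psi_i)\leq\sum_{i=1}^{n}f(\theta_i)f'(\theta_i)+\sum_{i=1}^{n}f(\psi_i)f'(\psi_i).$$ (ii)(2) If $f''(\theta)>0$ and $f'(\theta)<0$ on $(0,l)$, then $$2\sum_{i=1}^{n}f(\theta_i)f'(\psi_i)\geq\sum_{i=1}^{n}f(\theta_i)f'(\theta_i)+\sum_{i=1}^{n}f(\psi_i)f'(\psi_i).$$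 In each case, equality holds if and only if $\theta_i=\psi_i$ for all $i=1,\dots,n$. *)

theory Defs
  imports "HOL-Analysis.Analysis"
begin

text \<open>On an open set \<open>S\<close> the value of \<open>f\<close> outside \<open>S\<close> influences neither \<open>deriv f\<close> nor
  \<open>deriv (deriv f)\<close> on \<open>S\<close>, so a function defined on \<open>S\<close> only is rendered by a total one.\<close>

definition C2_on :: "real set \<Rightarrow> (real \<Rightarrow> real) \<Rightarrow> bool" where
  "C2_on S f \<longleftrightarrow> open S \<and> f differentiable_on S \<and> deriv f differentiable_on S
     \<and> continuous_on S (deriv (deriv f))"

end

theory Submission
  imports Defs
begin

text \<open>For fixed \<open>\<psi>\<close> put
  \<open>G \<theta> = 2 f(\<theta>) f'(\<psi>) - f(\<theta>) f'(\<theta>) - f(\<psi>) f'(\<psi>) - \<mu> (\<theta> - \<psi>)\<close>. The equation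
  \<open>f'\<^sup>2 - f f'' = \<mu>\<close> gives \<open>G' \<theta> = 2 f'(\<theta>) (f'(\<psi>) - f'(\<theta>))\<close>, so \<open>G\<close> has the sign of
  \<open>- f' f''\<close> except at its zero \<open>\<theta> = \<psi>\<close>. Summing over \<open>i\<close> removes the linear terms.\<close>

text \<open>The mean value theorem is used twice: for \<open>G\<close> between \<open>\<psi>\<close>
  and \<open>\<theta>\<close>, giving \<open>x\<close>, and for \<open>f'\<close> between
  \<open>\<psi>\<close> and \<open>x\<close>, giving \<open>y\<close>. The two points differ in
  general, so the sign is carried by a product of values at separate points.\<close>

lemma two_point_identity:
  fixes f f' f'' :: "real \<Rightarrow> real"
  assumes I: "is_interval I" "\<theta> \<in> I" "\<psi> \<in> I" and ne: "\<theta> \<noteq> \<psi>"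
    and f: "\<And>x. x \<in> I \<Longrightarrow> (f has_real_derivative f' x) (at x)"
    and f': "\<And>x. x \<in> I \<Longrightarrow> (f' has_real_derivative f'' x) (at x)"
    and ode: "\<And>x. x \<in> I \<Longrightarrow> (f' x)\<^sup>2 - f x * f'' x = \<mu>"
  obtains k x y where "k > 0" "x \<in> I" "y \<in> I"
    "2 * f \<theta> * f' \<psi> - f \<theta> * f' \<theta> - f \<psi> * f' \<psi> - \<mu> * (\<theta> - \<psi>) = - k * (f' x * f'' y)"
proof -
  define G where "G t = 2 * f t * f' \<psi> - f t * f' t - f \<psi> * f' \<psi> - \<mu> * (t - \<psi>)" for t
  \<comment> \<open>The endpoints come in either order, and strict betweenness is kept: it fixes the
    sign of \<open>k\<close> and makes a second application possible.\<close>
  have mvt: "\<exists>z\<in>I. ((a < z \<and> z < b) \<or> (b < z \<and> z < a)) \<and> g b - g a = (b - a) * g' z"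
    if ab: "a \<in> I" "b \<in> I" "a \<noteq> b"
      and g: "\<And>x. x \<in> I \<Longrightarrow> (g has_real_derivative g' x) (at x)" for a b g g'
  proof -
    have mem: "x \<in> I" if "(a \<le> x \<and> x \<le> b) \<or> (b \<le> x \<and> x \<le> a)" for x
      using I(1) ab that unfolding is_interval_1 by blast
    show ?thesis
    proof (cases "a < b")
      case True
      obtain z where "a < z" "z < b" "g b - g a = (b - a) * g' z"
        using MVT2[OF True, of g g'] mem g by blast
      then show ?thesis using mem[of z] by force
    next
      case False
      with ab have lt: "b < a" by simp
      obtain z where "b < z" "z < a" "g a - g b = (a - b) * g' z"
        using MVT2[OF lt, of g g'] mem g by blast
      then show ?thesis using mem[of z] by (intro bexI[of _ z]) (auto simp: algebra_simps)
    qed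
  qed
  \<comment> \<open>The product rule leaves \<open>- f x * f'' x - \<mu>\<close>, which the equation
    turns into \<open>- (f' x)\<^sup>2\<close>.\<close>
  have G': "(G has_real_derivative 2 * f' x * (f' \<psi> - f' x)) (at x)" if x: "x \<in> I" for x
    unfolding G_def
    by (rule derivative_eq_intros f[OF x] f'[OF x] refl)+
      (use ode[OF x] in \<open>simp add: algebra_simps power2_eq_square\<close>)
  from mvt[OF I(3,2) ne[symmetric] G'] obtain x where x: "x \<in> I"
      "(\<psi> < x \<and> x < \<theta>) \<or> (\<theta> < x \<and> x < \<psi>)"
      "G \<theta> - G \<psi> = (\<theta> - \<psi>) * (2 * f' x * (f' \<psi> - f' x))"
    by blast
  from x(2) have "\<psi> \<noteq> x" by auto
  from mvt[OF I(3) x(1) this f'] obtain y where y: "y \<in> I"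
      "f' x - f' \<psi> = (x - \<psi>) * f'' y"
    by blast
  have "G \<psi> = 0" by (simp add: G_def)
  moreover have "f' \<psi> - f' x = - ((x - \<psi>) * f'' y)" using y(2) by simp
  ultimately have "G \<theta> = - (2 * (\<theta> - \<psi>) * (x - \<psi>)) * (f' x * f'' y)"
    using x(3) by simp
  \<comment> \<open>This is \<open>k\<close>: both factors have the same sign because
    \<open>x\<close> lies strictly between \<open>\<psi>\<close> and
    \<open>\<theta>\<close>.\<close>
  moreover have "2 * (\<theta> - \<psi>) * (x - \<psi>) > 0"
    using x(2) by (auto intro: mult_pos_pos mult_neg_neg)
  ultimately show thesis using that x(1) y(1) unfolding G_def by blast
qed

text \<open>The two-point expressions, multiplied by \<open>s\<close>, are positive wherever
  \<open>\<theta> i \<noteq> \<psi> i\<close> and zero elsewhere; summing them gives both the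
  inequality and its equality case. Taking \<open>s\<close> to be 1 or -1 covers both directions at
  once.\<close>

lemma sum_deficit:
  fixes f f' f'' :: "real \<Rightarrow> real"
  assumes A: "finite A" "\<theta> ` A \<subseteq> I" "\<psi> ` A \<subseteq> I" "sum \<theta> A = sum \<psi> A"
    and I: "is_interval I"
    and f: "\<And>x. x \<in> I \<Longrightarrow> (f has_real_derivative f' x) (at x)"
    and f': "\<And>x. x \<in> I \<Longrightarrow> (f' has_real_derivative f'' x) (at x)"
    and ode: "\<And>x. x \<in> I \<Longrightarrow> (f' x)\<^sup>2 - f x * f'' x = \<mu>"
    and sgn: "\<And>x y. x \<in> I \<Longrightarrow> y \<in> I \<Longrightarrow> s * (f' x * f'' y) < 0"
  defines "D \<equiv> 2 * (\<Sum>i\<in>A. f (\<theta> i) * f' (\<psi> i))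
      - ((\<Sum>i\<in>A. f (\<theta> i) * f' (\<theta> i)) + (\<Sum>i\<in>A. f (\<psi> i) * f' (\<psi> i)))"
  shows "0 \<le> s * D" "D = 0 \<longleftrightarrow> (\<forall>i\<in>A. \<theta> i = \<psi> i)"
proof -
  \<comment> \<open>The linear term makes each summand nonnegative on its own; it cancels only in
    the sum, by the equal totals of \<open>\<theta>\<close> and \<open>\<psi>\<close>.\<close>
  define d where "d i = s * (2 * f (\<theta> i) * f' (\<psi> i) - f (\<theta> i) * f' (\<theta> i)
      - f (\<psi> i) * f' (\<psi> i) - \<mu> * (\<theta> i - \<psi> i))" for i
  have pos: "d i > 0" if i: "i \<in> A" "\<theta> i \<noteq> \<psi> i" for i
  proof -
    have "\<theta> i \<in> I" "\<psi> i \<in> I" using A i by auto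
    from two_point_identity[OF I this i(2) f f' ode] obtain k x y
      where k: "k > 0" "x \<in> I" "y \<in> I" "d i = s * (- k * (f' x * f'' y))"
      unfolding d_def by metis
    have "k * (s * (f' x * f'' y)) < 0"
      using k(1) sgn[OF k(2,3)] by (rule mult_pos_neg)
    then show ?thesis using k(4) by (simp add: algebra_simps)
  qed
  have zero: "d i = 0" if "\<theta> i = \<psi> i" for i using that by (simp add: d_def)
  have nonneg: "d i \<ge> 0" if "i \<in> A" for i using pos[OF that] zero[of i] by linarith
  have "sum d A = s * (D - \<mu> * (sum \<theta> A - sum \<psi> A))"
    unfolding d_def D_def
    by (simp add: sum_distrib_left sum_subtractf sum.distrib algebra_simps)
  then have sD: "sum d A = s * D" using A(4) by simp
  show "0 \<le> s * D" unfolding sD[symmetric] using nonneg by (rule sum_nonneg)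
  show "D = 0 \<longleftrightarrow> (\<forall>i\<in>A. \<theta> i = \<psi> i)"
  proof
    assume "D = 0"
    then have "\<forall>i\<in>A. d i = 0" using sD sum_nonneg_eq_0_iff[OF A(1) nonneg] by simp
    then show "\<forall>i\<in>A. \<theta> i = \<psi> i" using pos by force
  next
    assume "\<forall>i\<in>A. \<theta> i = \<psi> i"
    then show "D = 0" by (simp add: D_def)
  qed
qed

theorem theorem7:
  fixes n :: nat and l m \<mu> :: real
    and \<theta> \<psi> :: "nat \<Rightarrow> real" and f :: "real \<Rightarrow> real"
  assumes "n > 0" and "l > 0" and "0 < m" and "m < real n"
    and "\<forall>i\<in>{1..n}. \<theta> i \<in> {0<..<l}"
    and "\<forall>i\<in>{1..n}. \<psi> i \<in> {0<..<l}"
    and "(\<Sum>i=1..n. \<theta> i) = m * l"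
    and "(\<Sum>i=1..n. \<psi> i) = m * l"
    and "\<forall>x\<in>{0<..<l}. f x > 0"
    and "C2_on {0<..<l} f"
    and "\<forall>x\<in>{0<..<l}. (deriv f x)\<^sup>2 - f x * deriv (deriv f) x = \<mu>"
    and "\<forall>x\<in>{0<..<l}. deriv f x * deriv (deriv f) x \<noteq> 0"
  shows
    "((\<forall>x\<in>{0<..<l}. deriv (deriv f) x < 0 \<and> deriv f x > 0) \<longrightarrow>
        2 * (\<Sum>i=1..n. f (\<theta> i) * deriv f (\<psi> i))
          \<ge> (\<Sum>i=1..n. f (\<theta> i) * deriv f (\<theta> i)) + (\<Sum>i=1..n. f (\<psi> i) * deriv f (\<psi> i))
      \<and> (2 * (\<Sum>i=1..n. f (\<theta> i) * deriv f (\<psi> i))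
          = (\<Sum>i=1..n. f (\<theta> i) * deriv f (\<theta> i)) + (\<Sum>i=1..n. f (\<psi> i) * deriv f (\<psi> i))
          \<longleftrightarrow> (\<forall>i\<in>{1..n}. \<theta> i = \<psi> i)))
   \<and> ((\<forall>x\<in>{0<..<l}. deriv (deriv f) x < 0 \<and> deriv f x < 0) \<longrightarrow>
        2 * (\<Sum>i=1..n. f (\<theta> i) * deriv f (\<psi> i))
          \<le> (\<Sum>i=1..n. f (\<theta> i) * deriv f (\<theta> i)) + (\<Sum>i=1..n. f (\<psi> i) * deriv f (\<psi> i))
      \<and> (2 * (\<Sum>i=1..n. f (\<theta> i) * deriv f (\<psi> i))
          = (\<Sum>i=1..n. f (\<theta> i) * deriv f (\<theta> i)) + (\<Sum>i=1..n. f (\<psi> i) * deriv f (\<psi> i))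
          \<longleftrightarrow> (\<forall>i\<in>{1..n}. \<theta> i = \<psi> i)))
   \<and> ((\<forall>x\<in>{0<..<l}. deriv (deriv f) x > 0 \<and> deriv f x > 0) \<longrightarrow>
        2 * (\<Sum>i=1..n. f (\<theta> i) * deriv f (\<psi> i))
          \<le> (\<Sum>i=1..n. f (\<theta> i) * deriv f (\<theta> i)) + (\<Sum>i=1..n. f (\<psi> i) * deriv f (\<psi> i))
      \<and> (2 * (\<Sum>i=1..n. f (\<theta> i) * deriv f (\<psi> i))
          = (\<Sum>i=1..n. f (\<theta> i) * deriv f (\<theta> i)) + (\<Sum>i=1..n. f (\<psi> i) * deriv f (\<psi> i))
          \<longleftrightarrow> (\<forall>i\<in>{1..n}. \<theta> i = \<psi> i)))
   \<and> ((\<forall>x\<in>{0<..<l}. deriv (deriv f) x > 0 \<and> deriv f x < 0) \<longrightarrow>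
        2 * (\<Sum>i=1..n. f (\<theta> i) * deriv f (\<psi> i))
          \<ge> (\<Sum>i=1..n. f (\<theta> i) * deriv f (\<theta> i)) + (\<Sum>i=1..n. f (\<psi> i) * deriv f (\<psi> i))
      \<and> (2 * (\<Sum>i=1..n. f (\<theta> i) * deriv f (\<psi> i))
          = (\<Sum>i=1..n. f (\<theta> i) * deriv f (\<theta> i)) + (\<Sum>i=1..n. f (\<psi> i) * deriv f (\<psi> i))
          \<longleftrightarrow> (\<forall>i\<in>{1..n}. \<theta> i = \<psi> i)))"
proof -
  let ?I = "{0<..<l}"
  \<comment> \<open>Since the interval is open, differentiability on it is differentiability at each
    of its points.\<close>
  have der: "(f has_real_derivative deriv f x) (at x)"
      "(deriv f has_real_derivative deriv (deriv f) x) (at x)" if "x \<in> ?I" for x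
    using assms(10) that
    by (auto simp: C2_on_def differentiable_on_eq_differentiable_at DERIV_deriv_iff_real_differentiable)
  have img: "\<theta> ` {1..n} \<subseteq> ?I" "\<psi> ` {1..n} \<subseteq> ?I" using assms(5,6) by auto
  have sums: "sum \<theta> {1..n} = sum \<psi> {1..n}" using assms(7,8) by simp
  have ode: "(deriv f x)\<^sup>2 - f x * deriv (deriv f) x = \<mu>" if "x \<in> ?I" for x
    using assms(11) that by blast
  note deficit = sum_deficit[OF finite_atLeastAtMost img sums is_interval_oo der ode]
  \<comment> \<open>Opposite signs of \<open>deriv f\<close> and its derivative: the case
    \<open>s = 1\<close>. Equal signs, treated next, need \<open>s = -1\<close>.\<close>
  have pos: "2 * (\<Sum>i=1..n. f (\<theta> i) * deriv f (\<psi> i))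
        \<ge> (\<Sum>i=1..n. f (\<theta> i) * deriv f (\<theta> i)) + (\<Sum>i=1..n. f (\<psi> i) * deriv f (\<psi> i))
      \<and> (2 * (\<Sum>i=1..n. f (\<theta> i) * deriv f (\<psi> i))
        = (\<Sum>i=1..n. f (\<theta> i) * deriv f (\<theta> i)) + (\<Sum>i=1..n. f (\<psi> i) * deriv f (\<psi> i))
        \<longleftrightarrow> (\<forall>i\<in>{1..n}. \<theta> i = \<psi> i))"
    if "\<And>x y. x \<in> ?I \<Longrightarrow> y \<in> ?I \<Longrightarrow> deriv f x * deriv (deriv f) y < 0"
    using deficit[of 1] that by simp
  have neg: "2 * (\<Sum>i=1..n. f (\<theta> i) * deriv f (\<psi> i))
        \<le> (\<Sum>i=1..n. f (\<theta> i) * deriv f (\<theta> i)) + (\<Sum>i=1..n. f (\<psi> i) * deriv f (\<psi> i))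
      \<and> (2 * (\<Sum>i=1..n. f (\<theta> i) * deriv f (\<psi> i))
        = (\<Sum>i=1..n. f (\<theta> i) * deriv f (\<theta> i)) + (\<Sum>i=1..n. f (\<psi> i) * deriv f (\<psi> i))
        \<longleftrightarrow> (\<forall>i\<in>{1..n}. \<theta> i = \<psi> i))"
    if "\<And>x y. x \<in> ?I \<Longrightarrow> y \<in> ?I \<Longrightarrow> deriv f x * deriv (deriv f) y > 0"
    using deficit[of "-1"] that by simp
  show ?thesis
    \<comment> \<open>The direction of each inequality selects \<open>pos\<close> or
      \<open>neg\<close>. Each case fixes the two signs separately on the whole interval, hence the
      sign of the product at two different points.\<close>
    by (intro conjI[OF _ conjI[OF _ conjI]] impI)
      (rule pos neg, simp add: mult_pos_neg mult_neg_pos mult_neg_neg)+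
qed

end
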